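(* If $k\ge n\ge0$ are integers, then $\mathfrak{B}_{n,k}(x)$ is a polynomial. Moreover, it is quasipalindromic in the sense that $$\mathfrak{B}_{n,k}(x)=(-1)^n x^k\,\mathfrak{B}_{n,k}(x^{-1}).$$ For odd $n\ge3$ and $k\ge0$, $$\mathfrak{f}_{n,k}=(-1)^{k+1}\frac{2^{k+2}}{k+2}\,[x^{k+1}]\,\mathfrak{B}_{n,2(k+1)}(x).$$ In particular (for odd $n\ge3$), the central coefficient $[x^k]\,\mathfrak{B}_{n,2k}(x)$ of $\mathfrak{B}_{n,2k}(x)$ vanishes for $k\ge(n+1)/2$, as does the coefficient $\mathfrak{f}_{n,k}$ of the Faulhaber polynomial $F_n$ for $k\ge\mathbf{d}_n+1$.
   Context: Bernoulli polynomials: $\frac{te^{xt}}{e^t-1}=\sum_{n\ge0}\mathbf{B}_n(x)\frac{t^n}{n!}$, and $\mathbf{B}_n=\mathbf{B}_n(0)$ (so $\mathbf{B}_1=-\frac12$). The numbers $\mathfrak{B}_{n,k}=\sum_{\nu=k}^{n}\binom{n}{\nu}\binom{\nu}{k}\mathbf{B}_\nu$ ($0\le k\le n$) define the polynomial $\mathfrak{B}_n(x)=\sum_{k=0}^{n}\mathfrak{B}_{n,k}\,x^k$, and (to be distinguished from the numbers $\mathfrak{B}_{n,k}$) the formal power series $$\mathfrak{B}_{n,k}(x)=\mathfrak{B}_n(x)\,(x+1)^{k-n}=\mathfrak{B}_n(x)\sum_{\nu\ge0}\binom{k-n}{\nu}x^\nu\qquad(n\ge0,\ k\in\mathbb{Z}).$$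 $[x^k]f(x)$ denotes the coefficient of $x^k$ in the formal power series $f$. A polynomial $a_kx^k+\dots+a_0$ is called quasipalindromic (with respect to $k$, not necessarily its degree) if $|a_\nu|=|a_{k-\nu}|$ for $0\le\nu\le k$. Power sums: $S_n(x)=\frac{1}{n+1}(\mathbf{B}_{n+1}(x)-\mathbf{B}_{n+1})$, so $S_1(x)=\binom{x}{2}$. Faulhaber polynomials for odd index (classical Faulhaber–Jacobi theorem): for each odd $n\ge3$ there is a unique polynomial $F_n\in\mathbb{Q}[y]$, of degree $\mathbf{d}_n=\lfloor n/2\rfloor-1=(n-3)/2$, such that $S_n(x)=S_1(x)^2\,F_n(S_1(x))$. Its coefficients are denoted $F_n(y)=\sum_{k\ge0}\mathfrak{f}_{n,k}\,y^k$, with $\mathfrak{f}_{n,k}=0$ for $k>\mathbf{d}_n$. *)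

theory Defs
  imports "HOL-Computational_Algebra.Computational_Algebra"
begin

text \<open>Rational values of the Bernoulli polynomials, read off the exponential generating function
  \<open>t e\<^sup>x\<^sup>t / (e\<^sup>t - 1)\<close>. Since \<open>e\<^sup>t - 1\<close> has subdegree 1, the quotient is exact in the
  ring of power series in \<open>t\<close>.\<close>

definition bernpoly :: "nat \<Rightarrow> rat \<Rightarrow> rat" where
  "bernpoly n x = fact n * fps_nth (fps_X * fps_exp x / (fps_exp 1 - 1)) n"

definition bernoulli :: "nat \<Rightarrow> rat" where
  "bernoulli n = bernpoly n 0"

definition frakB_coeff :: "nat \<Rightarrow> nat \<Rightarrow> rat" where
  "frakB_coeff n k = (\<Sum>\<nu>=k..n. of_nat (n choose \<nu>) * of_nat (\<nu> choose k) * bernoulli \<nu>)"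

definition frakB_poly :: "nat \<Rightarrow> rat poly" where
  "frakB_poly n = (\<Sum>k=0..n. monom (frakB_coeff n k) k)"

text \<open>The formal power series \<open>B\<^sub>n(x) (x + 1)\<^sup>k\<^sup>-\<^sup>n\<close>, to be distinguished from the numbers
  \<^const>\<open>frakB_coeff\<close>. The exponent may be negative.\<close>

definition frakB_series :: "nat \<Rightarrow> int \<Rightarrow> rat fps" where
  "frakB_series n k = fps_of_poly (frakB_poly n) * fps_binomial (of_int (k - int n))"

text \<open>Here \<open>k\<close> is a bound on the degree, not necessarily the degree.\<close>

definition quasipalindromic :: "nat \<Rightarrow> rat poly \<Rightarrow> bool" where
  "quasipalindromic k p \<longleftrightarrow>
     degree p \<le> k \<and> (\<forall>\<nu>\<le>k. \<bar>coeff p \<nu>\<bar> = \<bar>coeff p (k - \<nu>)\<bar>)"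

definition power_sum :: "nat \<Rightarrow> rat \<Rightarrow> rat" where
  "power_sum n x = (bernpoly (n + 1) x - bernoulli (n + 1)) / of_nat (n + 1)"

text \<open>Only meaningful for odd \<open>n \<ge> 3\<close>, where the Faulhaber--Jacobi theorem provides existence.
  As \<open>\<rat>\<close> is infinite, the identity for all rational \<open>x\<close> amounts to the identity of polynomials.
  The degree of the polynomial is deliberately not part of the characterisation, since the
  identity already determines it.\<close>

definition faulhaber_poly :: "nat \<Rightarrow> rat poly" where
  "faulhaber_poly n =
     (THE F. \<forall>x. power_sum n x = (power_sum 1 x)\<^sup>2 * poly F (power_sum 1 x))"

definition faulhaber_coeff :: "nat \<Rightarrow> nat \<Rightarrow> rat" where
  "faulhaber_coeff n k = coeff (faulhaber_poly n) k"

text \<open>Natural subtraction: only used for \<open>n \<ge> 3\<close>.\<close>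

definition faulhaber_deg :: "nat \<Rightarrow> nat" where
  "faulhaber_deg n = n div 2 - 1"

text \<open>The value \<open>p(x\<^sup>-\<^sup>1)\<close> as a Laurent polynomial in the indeterminate \<open>x\<close>.\<close>

definition poly_at_X_inv :: "rat poly \<Rightarrow> rat fls" where
  "poly_at_X_inv p = poly (map_poly fls_const p) fls_X_inv"

end

theory Submission
  imports Defs
begin

text \<open>Since \<open>B\<^sub>n(x) = \<Sum>\<^sub>\<nu> (n choose \<nu>) B\<^sub>\<nu> x\<^sup>n\<^sup>-\<^sup>\<nu>\<close>, the series in question is
  \<open>(1 + x)\<^sup>k B\<^sub>n(1 / (1 + x))\<close>, and the quasipalindromy is the reflection
  \<open>B\<^sub>n(1 - y) = (-1)\<^sup>n B\<^sub>n(y)\<close> at \<open>y = 1 / (1 + x)\<close>. For the Faulhaber coefficients, differentiate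
  \<open>S\<^sub>n = s\<^sup>2 F\<^sub>n(s)\<close> with \<open>s = y (y - 1) / 2\<close> and substitute the same \<open>y\<close>: the series becomes a
  combination of the \<open>x\<^sup>j\<^sup>+\<^sup>1 (1 - x) (1 + x)\<^sup>2\<^sup>(\<^sup>k\<^sup>-\<^sup>j\<^sup>)\<^sup>-\<^sup>1\<close>, among which only \<open>j = k\<close> contributes to
  \<open>x\<^sup>k\<^sup>+\<^sup>1\<close>, because the two middle binomial coefficients of an odd row agree. The central
  coefficients vanish by quasipalindromy with sign \<open>-1\<close>.\<close>

section \<open>Polynomial identities and symmetries\<close>

text \<open>There are infinitely many positive points, and they avoid the poles 0 and -1 of the
  later substitutions \<open>inverse t\<close> and \<open>1 / (1 + t)\<close>.\<close>

lemma poly_eqI_pos: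
  fixes p q :: "'a :: linordered_field poly"
  assumes "\<And>t. t > 0 \<Longrightarrow> poly p t = poly q t"
  shows "p = q"
proof -
  have "{0<..} \<subseteq> {t. poly (p - q) t = 0}"
    using assms by auto
  then have "infinite {t. poly (p - q) t = 0}"
    using infinite_Ioi infinite_super by blast
  then show ?thesis
    using poly_roots_finite[of "p - q"] by auto
qed

text \<open>The reversal \<open>q\<close> of \<open>p\<close> with respect to \<open>k\<close> takes
  the value \<open>t ^ k * poly p (inverse t)\<close> at every \<open>t > 0\<close>, so the
  functional equation forces \<open>q = smult c p\<close>.\<close>

lemma coeff_reflect_eq:
  fixes p :: "'a :: linordered_field poly"
  assumes deg: "degree p \<le> k"
    and refl: "\<And>t. t > 0 \<Longrightarrow> t ^ k * poly p (inverse t) = c * poly p t"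
    and "i \<le> k"
  shows "coeff p (k - i) = c * coeff p i"
proof -
  define q where "q = (\<Sum>j\<le>k. monom (coeff p j) (k - j))"
  have "poly q t = poly (smult c p) t" if "t > 0" for t
  proof -
    have "t ^ k * poly p (inverse t) = (\<Sum>j\<le>k. t ^ k * (coeff p j * inverse t ^ j))"
      by (subst poly_as_sum_of_monoms'[OF deg, symmetric])
        (simp add: poly_sum poly_monom sum_distrib_left)
    also have "\<dots> = poly q t"
      using that unfolding q_def poly_sum poly_monom
      by (intro sum.cong) (auto simp: power_diff field_simps)
    finally show ?thesis
      using refl[OF that] by simp
  qed
  then have "q = smult c p"
    by (rule poly_eqI_pos)
  moreover have "coeff q i = coeff p (k - i)"
  proof -
    have "coeff q i = (\<Sum>j\<le>k. if j = k - i then coeff p j else 0)"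
      unfolding q_def coeff_sum using \<open>i \<le> k\<close> by (intro sum.cong) auto
    then show ?thesis by simp
  qed
  ultimately show ?thesis by simp
qed

text \<open>Induction on the degree: \<open>P - P(0)\<close> vanishes at 0 and, by invariance, at 1.
  Hence it is divisible by \<open>s = x (x - 1) / 2\<close>, and the quotient is again invariant, of
  degree lower by two.\<close>

lemma reflection_invariant_poly:
  fixes P :: "'a :: field_char_0 poly"
  assumes "pcompose P [:1, -1:] = P"
  shows "\<exists>Q. P = pcompose Q [:0, -1/2, 1/2:]"
  using assms
proof (induction "degree P" arbitrary: P rule: less_induct)
  case less
  let ?s = "[:0, -1/2, 1/2:] :: 'a poly"
  show ?case
  proof (cases "degree P = 0")
    case True
    then obtain c where "P = [:c:]"
      by (auto elim: degree_eq_zeroE)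
    then have "P = pcompose [:c:] ?s" by simp
    then show ?thesis by blast
  next
    case False
    define c where "c = poly P 0"
    have "[:-0, 1:] dvd P - [:c:]"
      by (subst poly_eq_0_iff_dvd[symmetric]) (simp add: c_def)
    then obtain A where A: "P - [:c:] = [:0, 1:] * A"
      by (auto elim: dvdE)
    have "poly P 1 = poly (pcompose P [:1, -1:]) 0"
      by (simp add: poly_pcompose)
    then have "poly P 1 = c"
      using less.prems by (simp add: c_def)
    then have "poly A 1 = 0"
      using arg_cong[OF A, of "\<lambda>p. poly p 1"] by simp
    then obtain R where R: "A = [:-1, 1:] * R"
      using poly_eq_0_iff_dvd by (metis dvdE)
    have P: "P = [:c:] + ?s * smult 2 R"
      using A unfolding R by (simp add: algebra_simps)
    have "R \<noteq> 0"
      using P False by auto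
    have deg_sR: "degree (?s * smult 2 R) = 2 + degree R"
      using \<open>R \<noteq> 0\<close> by (subst degree_mult_eq) auto
    have deg: "degree P = 2 + degree R"
      unfolding P by (subst degree_add_eq_right) (simp_all only: deg_sR, simp)
    have inv_s: "pcompose ?s [:1, -1:] = ?s"
      by (simp add: pcompose_pCons)
    have "?s * pcompose (smult 2 R) [:1, -1:] = ?s * smult 2 R"
    proof -
      have "[:c:] + pcompose ?s [:1, -1:] * pcompose (smult 2 R) [:1, -1:] =
          pcompose ([:c:] + ?s * smult 2 R) [:1, -1:]"
        by (simp only: pcompose_add pcompose_mult pcompose_const)
      also have "\<dots> = [:c:] + ?s * smult 2 R"
        using less.prems P by simp
      finally show ?thesis
        unfolding inv_s by simp
    qed
    then have "pcompose (smult 2 R) [:1, -1:] = smult 2 R"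
      by (subst (asm) mult_left_cancel) auto
    then obtain Q where Q: "smult 2 R = pcompose Q ?s"
      using less.hyps[of "smult 2 R"] deg by auto
    \<comment> \<open>One Horner step in \<open>s\<close>: \<open>P = c + s * Q(s)\<close>.\<close>
    have "P = pcompose ([:c:] + [:0, 1:] * Q) ?s"
      unfolding pcompose_add pcompose_mult using P Q by (simp add: pcompose_pCons)
    then show ?thesis by blast
  qed
qed

section \<open>Bernoulli polynomials and their generating function\<close>

lemma fps_exp_minus_one_dvd_X: "(fps_exp 1 - 1 :: 'a :: field_char_0 fps) dvd fps_X"
proof -
  have "subdegree (fps_exp 1 - 1 :: 'a fps) = 1"
    by (rule subdegreeI) auto
  then show ?thesis
    by (subst fps_dvd_iff) auto
qed

lemma bernpoly_egf:
  "fps_X * fps_exp x / (fps_exp 1 - 1) = Abs_fps (\<lambda>n. bernpoly n x / fact n)"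
  by (simp add: fps_eq_iff bernpoly_def)

lemma bernpoly_egf_mult:
  "Abs_fps (\<lambda>n. bernpoly n x / fact n) * (fps_exp 1 - 1) = fps_X * fps_exp x"
  unfolding bernpoly_egf[symmetric]
  by (intro dvd_div_mult_self dvd_mult2 fps_exp_minus_one_dvd_X)

text \<open>Cancelling the nonzero \<open>fps_exp 1 - 1\<close> reduces each formula for
  \<open>bernpoly\<close> to exhibiting a series \<open>G\<close> that satisfies the multiplied-out
  equation.\<close>

lemma bernpoly_egf_unique:
  assumes "G * (fps_exp 1 - 1) = fps_X * fps_exp x"
  shows "bernpoly n x = fact n * fps_nth G n"
proof -
  have "G * (fps_exp 1 - 1) = Abs_fps (\<lambda>n. bernpoly n x / fact n) * (fps_exp 1 - 1)"
    using assms by (simp add: bernpoly_egf_mult)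
  then have "G = Abs_fps (\<lambda>n. bernpoly n x / fact n)"
    by simp
  then show ?thesis by simp
qed

lemma bernpoly_eq_sum:
  "bernpoly n x = (\<Sum>j\<le>n. of_nat (n choose j) * bernoulli (n - j) * x ^ j)"
proof -
  define H where "H = Abs_fps (\<lambda>n. bernoulli n / fact n)"
  have "H * (fps_exp 1 - 1) = fps_X"
    using bernpoly_egf_mult[of 0] by (simp add: H_def bernoulli_def)
  then have "(fps_exp x * H) * (fps_exp 1 - 1) = fps_X * fps_exp x"
    by (simp add: mult_ac)
  then have "bernpoly n x = fact n * fps_nth (fps_exp x * H) n"
    by (rule bernpoly_egf_unique)
  also have "\<dots> = (\<Sum>j\<le>n. fact n * (x ^ j / fact j * (bernoulli (n - j) / fact (n - j))))"
    by (simp add: fps_mult_nth H_def sum_distrib_left atLeast0AtMost)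
  also have "\<dots> = (\<Sum>j\<le>n. of_nat (n choose j) * bernoulli (n - j) * x ^ j)"
    by (intro sum.cong) (auto simp: binomial_fact)
  finally show ?thesis .
qed

text \<open>Replacing \<open>t\<close> by \<open>-t\<close> in the generating function at
  \<open>x\<close> yields the one at \<open>1 - x\<close>, once the defining equation is multiplied
  by the exponential series.\<close>

lemma bernpoly_reflect: "bernpoly n (1 - x) = (- 1) ^ n * bernpoly n x"
proof -
  define F where "F = Abs_fps (\<lambda>n. bernpoly n x / fact n)"
  define F' where "F' = fps_compose F (- fps_X)"
  have exp_compose: "fps_compose (fps_exp a) (- fps_X) = fps_exp (- a)" for a :: rat
    using fps_exp_compose_linear[of a "- 1"] by (simp flip: fps_const_neg)
  have "F' * (fps_exp (- 1) - 1) = fps_compose (F * (fps_exp 1 - 1)) (- fps_X)"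
    by (simp add: F'_def fps_compose_mult_distrib fps_compose_sub_distrib exp_compose)
  also have "\<dots> = - fps_X * fps_exp (- x)"
    by (simp add: F_def bernpoly_egf_mult fps_compose_mult_distrib exp_compose)
  finally have *: "F' * (fps_exp (- 1) - 1) = - fps_X * fps_exp (- x)" .
  have "fps_exp 1 * (F' * (fps_exp (- 1) - 1)) = F' * (fps_exp (1 + - 1) - fps_exp 1)"
    unfolding fps_exp_add_mult by (simp add: algebra_simps)
  then have "F' * (fps_exp 1 - 1) = - (fps_exp 1 * (F' * (fps_exp (- 1) - 1)))"
    by (simp add: algebra_simps)
  also have "\<dots> = fps_X * (fps_exp 1 * fps_exp (- x))"
    unfolding * by (simp add: mult_ac)
  also have "\<dots> = fps_X * fps_exp (1 - x)"
    unfolding fps_exp_add_mult[symmetric] by simp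
  finally have "bernpoly n (1 - x) = fact n * fps_nth F' n"
    by (rule bernpoly_egf_unique)
  then show ?thesis
    by (simp add: F'_def F_def fps_compose_uminus')
qed

text \<open>The generating functions at 1 and at 0 differ by exactly \<open>fps_X\<close>, which
  only affects the index 1.\<close>

lemma bernpoly_1:
  assumes "n \<noteq> 1"
  shows "bernpoly n 1 = bernoulli n"
proof -
  define H where "H = Abs_fps (\<lambda>n. bernoulli n / fact n)"
  have "H * (fps_exp 1 - 1) = fps_X"
    using bernpoly_egf_mult[of 0] by (simp add: H_def bernoulli_def)
  then have "(H + fps_X) * (fps_exp 1 - 1) = fps_X * fps_exp 1"
    by (simp add: algebra_simps)
  then have "bernpoly n 1 = fact n * fps_nth (H + fps_X) n"
    by (rule bernpoly_egf_unique)
  then show ?thesis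
    using assms by (simp add: H_def)
qed

lemma bernoulli_odd: "odd n \<Longrightarrow> n \<noteq> 1 \<Longrightarrow> bernoulli n = 0"
  using bernpoly_reflect[of n 0] by (simp add: bernpoly_1 bernoulli_def)

lemma bernoulli_0: "bernoulli 0 = 1"
proof -
  have "fps_nth (Abs_fps (\<lambda>n. bernpoly n 0 / fact n) * (fps_exp 1 - 1)) 1 = 1"
    unfolding bernpoly_egf_mult by simp
  then show ?thesis
    by (simp add: fps_mult_nth bernoulli_def)
qed

text \<open>Reflection equates the values of the second Bernoulli polynomial at 0 and 1, whose
  difference is \<open>1 + 2 * bernoulli 1\<close>.\<close>

lemma bernoulli_1: "bernoulli 1 = - 1 / 2"
proof -
  have "bernpoly 2 1 = bernpoly 2 0"
    using bernpoly_reflect[of 2 0] by simp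
  then show ?thesis
    by (simp add: bernpoly_eq_sum numeral_2_eq_2 bernoulli_0)
qed

lemma power_sum_1: "power_sum 1 x = poly [:0, -1/2, 1/2:] x"
  by (simp add: power_sum_def bernpoly_eq_sum numeral_2_eq_2 bernoulli_0 bernoulli_1[simplified]
      field_simps)

text \<open>\<open>bernpoly\<close> only gives values; degrees, derivatives and compositions need
  the polynomial itself.\<close>

definition bernoulli_poly :: "nat \<Rightarrow> rat poly" where
  "bernoulli_poly n = (\<Sum>j\<le>n. monom (of_nat (n choose j) * bernoulli (n - j)) j)"

lemma poly_bernoulli_poly: "poly (bernoulli_poly n) x = bernpoly n x"
  by (simp add: bernoulli_poly_def bernpoly_eq_sum poly_sum poly_monom)

lemma coeff_bernoulli_poly:
  "coeff (bernoulli_poly n) j = of_nat (n choose j) * bernoulli (n - j)"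
  by (simp add: bernoulli_poly_def coeff_sum)

lemma degree_bernoulli_poly_le: "degree (bernoulli_poly n) \<le> n"
  by (rule degree_le) (simp add: coeff_bernoulli_poly)

text \<open>Coefficientwise this is the absorption identity for binomial coefficients.\<close>

lemma pderiv_bernoulli_poly:
  "pderiv (bernoulli_poly (Suc n)) = smult (of_nat (Suc n)) (bernoulli_poly n)"
proof (rule poly_eqI)
  fix j
  have "(of_nat (Suc j * (Suc n choose Suc j)) :: rat) = of_nat (Suc n * (n choose j))"
    by (simp only: Suc_times_binomial_eq mult.commute)
  then show "coeff (pderiv (bernoulli_poly (Suc n))) j =
      coeff (smult (of_nat (Suc n)) (bernoulli_poly n)) j"
    unfolding coeff_pderiv coeff_smult coeff_bernoulli_poly of_nat_mult diff_Suc_Suc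
    by (metis mult.assoc)
qed

section \<open>Quasipalindromy of the series\<close>

text \<open>After swapping the sums, the inner one is the binomial expansion of
  \<open>(1 + t) ^ \<nu>\<close>. Reversing the outer index and extracting
  \<open>(1 + t) ^ n\<close> leaves a Bernoulli polynomial.\<close>

lemma poly_frakB_poly:
  assumes "t \<noteq> - 1"
  shows "poly (frakB_poly n) t = (1 + t) ^ n * bernpoly n (1 / (1 + t))"
proof -
  \<comment> \<open>The added terms with \<open>\<nu> < k\<close> are zero; a range independent of
    \<open>k\<close> lets the sums be swapped.\<close>
  have "frakB_coeff n k = (\<Sum>\<nu>\<le>n. of_nat (n choose \<nu>) * of_nat (\<nu> choose k) * bernoulli \<nu>)" for k
    unfolding frakB_coeff_def by (intro sum.mono_neutral_left) (auto simp: binomial_eq_0)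
  then have "poly (frakB_poly n) t =
      (\<Sum>k\<le>n. \<Sum>\<nu>\<le>n. of_nat (n choose \<nu>) * bernoulli \<nu> * (of_nat (\<nu> choose k) * t ^ k))"
    by (simp add: frakB_poly_def poly_sum poly_monom sum_distrib_right sum_distrib_left mult_ac
        atLeast0AtMost)
  also have "\<dots> = (\<Sum>\<nu>\<le>n. of_nat (n choose \<nu>) * bernoulli \<nu> * (\<Sum>k\<le>n. of_nat (\<nu> choose k) * t ^ k))"
    by (subst sum.swap) (simp add: sum_distrib_left)
  also have "\<dots> = (\<Sum>\<nu>\<le>n. of_nat (n choose \<nu>) * bernoulli \<nu> * (1 + t) ^ \<nu>)"
  proof (intro sum.cong refl arg_cong2[where f = "(*)"])
    fix \<nu> assume "\<nu> \<in> {..n}"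
    then have "(\<Sum>k\<le>n. of_nat (\<nu> choose k) * t ^ k) = (\<Sum>k\<le>\<nu>. of_nat (\<nu> choose k) * t ^ k)"
      by (intro sum.mono_neutral_right) (auto simp: binomial_eq_0)
    also have "\<dots> = (1 + t) ^ \<nu>"
      using binomial_ring[of t 1 \<nu>] by (simp add: add.commute)
    finally show "(\<Sum>k\<le>n. of_nat (\<nu> choose k) * t ^ k) = (1 + t) ^ \<nu>" .
  qed
  also have "\<dots> = (\<Sum>j\<le>n. of_nat (n choose (n - j)) * bernoulli (n - j) * (1 + t) ^ (n - j))"
    by (rule sum.reindex_bij_witness[of _ "\<lambda>j. n - j" "\<lambda>j. n - j"]) auto
  also have "\<dots> = (\<Sum>j\<le>n. (1 + t) ^ n * (of_nat (n choose j) * bernoulli (n - j) * (1 / (1 + t)) ^ j))"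
  proof (intro sum.cong refl)
    fix j assume "j \<in> {..n}"
    moreover have "1 + t \<noteq> 0"
      using assms by (simp add: add_eq_0_iff)
    ultimately show "of_nat (n choose (n - j)) * bernoulli (n - j) * (1 + t) ^ (n - j) =
        (1 + t) ^ n * (of_nat (n choose j) * bernoulli (n - j) * (1 / (1 + t)) ^ j)"
      by (simp add: power_diff power_divide binomial_symmetric[of j n])
  qed
  finally show ?thesis
    by (simp add: bernpoly_eq_sum sum_distrib_left)
qed

lemma degree_frakB_poly_le: "degree (frakB_poly n) \<le> n"
  unfolding frakB_poly_def by (intro degree_sum_le) (auto intro: order_trans[OF degree_monom_le])

lemma frakB_series_eq_poly:
  assumes "n \<le> k"
  shows "frakB_series n (int k) = fps_of_poly (frakB_poly n * [:1, 1:] ^ (k - n))"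
proof -
  have "(of_int (int k - int n) :: rat) = of_nat (k - n)"
    using assms by simp
  then show ?thesis
    unfolding frakB_series_def fps_of_poly_mult fps_of_poly_power
    by (simp only: fps_binomial_of_nat) (simp add: fps_of_poly_linear')
qed

lemma degree_frakB_poly_mult_le:
  assumes "n \<le> k"
  shows "degree (frakB_poly n * [:1, 1:] ^ (k - n)) \<le> k"
proof -
  have "degree (frakB_poly n * [:1, 1:] ^ (k - n)) \<le>
      degree (frakB_poly n) + degree ([:1, 1:] :: rat poly) * (k - n)"
    by (meson degree_mult_le degree_power_le add_left_mono order_trans)
  then show ?thesis
    using degree_frakB_poly_le[of n] assms by simp
qed

text \<open>The map \<open>t \<mapsto> inverse t\<close> sends \<open>y = 1 / (1 + t)\<close> to
  \<open>1 - y\<close>, so \<open>bernpoly_reflect\<close> supplies the functional equation for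
  \<open>coeff_reflect_eq\<close>.\<close>

lemma frakB_series_symmetric:
  assumes "n \<le> k" "i \<le> k"
  shows "fps_nth (frakB_series n (int k)) (k - i) =
    (- 1) ^ n * fps_nth (frakB_series n (int k)) i"
proof -
  define p where "p = frakB_poly n * [:1, 1:] ^ (k - n)"
  have deg: "degree p \<le> k"
    unfolding p_def using assms(1) by (rule degree_frakB_poly_mult_le)
  have p: "poly p t = (1 + t) ^ k * bernpoly n (1 / (1 + t))" if "t > 0" for t
    using that assms(1) by (simp add: p_def poly_frakB_poly flip: power_add)
  have "t ^ k * poly p (inverse t) = (- 1) ^ n * poly p t" if "t > 0" for t
  proof -
    have "t ^ k * (1 + inverse t) ^ k = (1 + t) ^ k"
      using that by (simp add: algebra_simps flip: power_mult_distrib)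
    moreover have "1 / (1 + inverse t) = 1 - 1 / (1 + t)"
      using that by (simp add: divide_simps add_pos_pos)
    ultimately show ?thesis
      using p[OF that] p[of "inverse t"] that by (simp add: bernpoly_reflect flip: mult.assoc)
  qed
  from coeff_reflect_eq[OF deg this \<open>i \<le> k\<close>] show ?thesis
    unfolding frakB_series_eq_poly[OF assms(1)] by (simp add: p_def)
qed

text \<open>The degree bound keeps every exponent natural, so that the product can be compared
  termwise with an embedded polynomial.\<close>

lemma fls_X_power_times_poly_at_X_inv:
  assumes "degree p \<le> k"
  shows "fls_X ^ k * poly_at_X_inv p = (\<Sum>i\<le>k. fls_const (coeff p i) * fls_X ^ (k - i))"
proof -
  have "poly_at_X_inv p = (\<Sum>i\<le>degree p. fls_const (coeff p i) * fls_X_inv ^ i)"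
    unfolding poly_at_X_inv_def poly_altdef by (simp add: coeff_map_poly degree_map_poly)
  also have "\<dots> = (\<Sum>i\<le>k. fls_const (coeff p i) * fls_X_inv ^ i)"
    using assms by (intro sum.mono_neutral_left) (auto simp: coeff_eq_0)
  finally have "fls_X ^ k * poly_at_X_inv p =
      (\<Sum>i\<le>k. fls_const (coeff p i) * (fls_X ^ k * fls_X_inv ^ i))"
    by (simp add: sum_distrib_left mult_ac)
  also have "\<dots> = (\<Sum>i\<le>k. fls_const (coeff p i) * fls_X ^ (k - i))"
    by (intro sum.cong refl arg_cong2[where f = "(*)"])
      (auto simp: power_diff divide_inverse fls_inverse_X simp flip: power_inverse)
  finally show ?thesis .
qed

lemma fps_to_fls_fps_of_poly:
  fixes p :: "'a :: comm_ring_1 poly"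
  assumes "degree p \<le> k"
  shows "fps_to_fls (fps_of_poly p) = (\<Sum>i\<le>k. fls_const (coeff p i) * fls_X ^ i)"
proof -
  have "fps_of_poly p = (\<Sum>i\<le>k. fps_const (coeff p i) * fps_X ^ i)"
    by (subst poly_as_sum_of_monoms'[OF assms, symmetric])
      (simp only: fps_of_poly_sum fps_of_poly_monom)
  then show ?thesis
    by (simp add: sum_comp_morphism[of fps_to_fls, unfolded o_def, symmetric] fls_times_fps_to_fls fps_to_fls_power)
qed

lemma frakB_series_quasipalindromic:
  assumes "n \<le> k"
  shows "\<exists>p. frakB_series n (int k) = fps_of_poly p \<and> quasipalindromic k p \<and>
    fps_to_fls (frakB_series n (int k)) = (- 1) ^ n * fls_X ^ k * poly_at_X_inv p"
proof -
  define p where "p = frakB_poly n * [:1, 1:] ^ (k - n)"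
  have series: "frakB_series n (int k) = fps_of_poly p"
    unfolding p_def using assms by (rule frakB_series_eq_poly)
  have deg: "degree p \<le> k"
    unfolding p_def using assms by (rule degree_frakB_poly_mult_le)
  have sym: "coeff p (k - i) = (- 1) ^ n * coeff p i" if "i \<le> k" for i
    using frakB_series_symmetric[OF assms that] by (simp add: series)
  have "quasipalindromic k p"
    using deg by (simp add: quasipalindromic_def sym abs_mult)
  moreover have "fps_to_fls (fps_of_poly p) = (- 1) ^ n * fls_X ^ k * poly_at_X_inv p"
  proof -
    have "fps_to_fls (fps_of_poly p) = (\<Sum>i\<le>k. fls_const (coeff p (k - i)) * fls_X ^ (k - i))"
      unfolding fps_to_fls_fps_of_poly[OF deg]
      by (rule sum.reindex_bij_witness[of _ "\<lambda>i. k - i" "\<lambda>i. k - i"]) auto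
    also have "\<dots> = (\<Sum>i\<le>k. (- 1) ^ n * (fls_const (coeff p i) * fls_X ^ (k - i)))"
      by (intro sum.cong)
        (auto simp: sym fls_const_power mult_ac simp flip: fls_const_mult_const)
    finally show ?thesis
      by (simp add: fls_X_power_times_poly_at_X_inv[OF deg] mult.assoc sum_distrib_left)
  qed
  ultimately show ?thesis
    using series by auto
qed

text \<open>The central coefficient is its own mirror image, so for odd \<open>n\<close> it equals
  its negative.\<close>

lemma frakB_series_central_zero:
  assumes "odd n" "n \<le> 2 * k"
  shows "fps_nth (frakB_series n (2 * int k)) k = 0"
  using frakB_series_symmetric[of n "2 * k" k] assms by simp

section \<open>Faulhaber polynomials\<close>

text \<open>Since \<open>Suc n\<close> is even, the power sum polynomial \<open>P\<close> is
  reflection invariant, hence \<open>P = Q(s)\<close>. The two lowest coefficients of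
  \<open>Q\<close> vanish because \<open>P\<close> and its derivative, the \<open>n\<close>-th
  Bernoulli polynomial, vanish at 0.\<close>

lemma faulhaber_composition:
  assumes "n = 2 * m + 3"
  obtains F where "degree F \<le> m"
    and "bernoulli_poly (Suc n) - [:bernoulli (Suc n):] =
      smult (of_nat (Suc n)) (pcompose (monom 1 2 * F) [:0, -1/2, 1/2:])"
proof -
  let ?s = "[:0, -1/2, 1/2:] :: rat poly"
  define P where "P = smult (1 / of_nat (Suc n)) (bernoulli_poly (Suc n) - [:bernoulli (Suc n):])"
  have "even (Suc n)" using assms by simp
  then have "poly (pcompose P [:1, -1:]) x = poly P x" for x
    using bernpoly_reflect[of "Suc n" x] by (simp add: P_def poly_pcompose poly_bernoulli_poly)
  then have "pcompose P [:1, -1:] = P"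
    by (simp add: poly_eq_poly_eq_iff[symmetric] fun_eq_iff)
  then obtain Q where Q: "P = pcompose Q ?s"
    using reflection_invariant_poly by blast
  have "degree P \<le> Suc n"
    unfolding P_def by (intro order_trans[OF degree_smult_le] degree_diff_le degree_bernoulli_poly_le) simp
  then have degQ: "degree Q \<le> m + 2"
    unfolding Q degree_pcompose using assms by simp
  have "poly P 0 = 0"
    by (simp add: P_def poly_bernoulli_poly bernoulli_def)
  then have Q0: "coeff Q 0 = 0"
    by (simp add: Q poly_pcompose poly_0_coeff_0)
  have "pderiv P = bernoulli_poly n"
    by (simp add: P_def pderiv_smult pderiv_diff pderiv_bernoulli_poly pderiv_pCons del: of_nat_Suc)
  moreover have "bernoulli n = 0"
    using assms by (intro bernoulli_odd) auto
  ultimately have "poly (pderiv P) 0 = 0"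
    by (simp add: poly_bernoulli_poly flip: bernoulli_def)
  \<comment> \<open>Chain rule at 0, where \<open>s\<close> is 0 and its derivative is the nonzero
    number \<open>-1/2\<close>.\<close>
  then have "poly (pderiv Q) 0 = 0"
    by (simp add: Q pderiv_pcompose poly_pcompose pderiv_pCons)
  then have Q1: "coeff Q 1 = 0"
    by (simp add: poly_0_coeff_0 coeff_pderiv)
  have "Q = monom 1 2 * poly_shift 2 Q"
  proof (rule poly_eqI)
    fix i
    show "coeff Q i = coeff (monom 1 2 * poly_shift 2 Q) i"
      using Q0 Q1 by (cases "i < 2")
        (auto simp: less_2_cases_iff coeff_monom_mult coeff_poly_shift simp del: add_2_eq_Suc')
  qed
  moreover have "degree (poly_shift 2 Q) \<le> m"
    using degQ by (intro degree_le) (auto simp: coeff_poly_shift intro: coeff_eq_0)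
  moreover have "bernoulli_poly (Suc n) - [:bernoulli (Suc n):] = smult (of_nat (Suc n)) P"
    by (simp add: P_def del: of_nat_Suc)
  ultimately show ?thesis
    using that[of "poly_shift 2 Q"] Q by simp
qed

text \<open>Uniqueness behind the definite description: the square of \<open>s\<close> cancels, and
  composition with the nonconstant \<open>s\<close> is injective.\<close>

lemma faulhaber_poly_eqI:
  assumes F: "\<And>x. power_sum n x = (power_sum 1 x)\<^sup>2 * poly F (power_sum 1 x)"
  shows "faulhaber_poly n = F"
  unfolding faulhaber_poly_def
proof (rule the_equality)
  fix G assume G: "\<forall>x. power_sum n x = (power_sum 1 x)\<^sup>2 * poly G (power_sum 1 x)"
  let ?s = "[:0, -1/2, 1/2:] :: rat poly"
  have "?s\<^sup>2 * pcompose G ?s = ?s\<^sup>2 * pcompose F ?s"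
    unfolding poly_eq_poly_eq_iff[symmetric] fun_eq_iff
    using F G by (simp add: power_sum_1 poly_pcompose del: One_nat_def)
  then have "pcompose (G - F) ?s = 0"
    by (simp add: pcompose_diff)
  then show "G = F"
    by (simp add: pcompose_eq_0_iff)
qed (use F in blast)

text \<open>Differentiating the Faulhaber identity expresses the \<open>n\<close>-th Bernoulli
  polynomial through \<open>s\<close> and its derivative, which at \<open>1 / (1 + t)\<close> are
  \<open>- t / (2 * (1 + t)\<^sup>2)\<close> and \<open>(1 - t) / (2 * (1 + t))\<close>.\<close>

lemma frakB_poly_faulhaber:
  assumes "n = 2 * m + 3"
  shows "degree (faulhaber_poly n) \<le> m"
    and "frakB_poly n = (\<Sum>j\<le>m.
      smult (faulhaber_coeff n j * of_nat (j + 2) / 2 * (- 1 / 2) ^ (j + 1))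
        (monom 1 (j + 1) * ([:1, -1:] * [:1, 1:] ^ (2 * (m - j)))))"
proof -
  let ?s = "[:0, -1/2, 1/2:] :: rat poly"
  obtain F where deg: "degree F \<le> m" and
    F: "bernoulli_poly (Suc n) - [:bernoulli (Suc n):] =
      smult (of_nat (Suc n)) (pcompose (monom 1 2 * F) ?s)"
    using faulhaber_composition[OF assms] .
  have "power_sum n x = (power_sum 1 x)\<^sup>2 * poly F (power_sum 1 x)" for x
    using arg_cong[OF F, of "\<lambda>p. poly p x"]
    unfolding power_sum_def[of n] power_sum_1 Suc_eq_plus1[symmetric]
    by (simp add: poly_bernoulli_poly poly_pcompose poly_monom del: of_nat_Suc)
  then have faul: "faulhaber_poly n = F"
    by (rule faulhaber_poly_eqI)
  show "degree (faulhaber_poly n) \<le> m"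
    using deg faul by simp
  have "smult (of_nat (Suc n)) (bernoulli_poly n) =
      smult (of_nat (Suc n)) (pcompose (pderiv (monom 1 2 * F)) ?s * pderiv ?s)"
    using arg_cong[OF F, of pderiv]
    by (simp add: pderiv_diff pderiv_smult pderiv_bernoulli_poly pderiv_pcompose pderiv_pCons
        del: of_nat_Suc)
  then have "smult (of_nat (Suc n)) (bernoulli_poly n -
      pcompose (pderiv (monom 1 2 * F)) ?s * pderiv ?s) = 0"
    unfolding smult_diff_right by (simp only: diff_self)
  then have bern: "bernoulli_poly n = pcompose (pderiv (monom 1 2 * F)) ?s * pderiv ?s"
    unfolding smult_eq_0_iff by (simp del: of_nat_Suc)
  have dF: "pderiv (monom 1 2 * F) = (\<Sum>j\<le>m. monom (of_nat (j + 2) * coeff F j) (j + 1))"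
  proof -
    have "monom 1 2 * F = (\<Sum>j\<le>m. monom (coeff F j) (j + 2))"
      by (subst poly_as_sum_of_monoms'[OF deg, symmetric])
        (simp add: sum_distrib_left mult_monom add.commute)
    then show ?thesis
      by (simp add: sum_comp_morphism[of pderiv, unfolded o_def, symmetric] pderiv_add pderiv_monom)
  qed
  show "frakB_poly n = (\<Sum>j\<le>m.
      smult (faulhaber_coeff n j * of_nat (j + 2) / 2 * (- 1 / 2) ^ (j + 1))
        (monom 1 (j + 1) * ([:1, -1:] * [:1, 1:] ^ (2 * (m - j)))))"
  proof (rule poly_eqI_pos)
    fix t :: rat assume "t > 0"
    define u where "u = 1 + t"
    have "u \<noteq> 0" using \<open>t > 0\<close> by (simp add: u_def)
    have s: "poly ?s (1 / u) = - 1 / 2 * t / u\<^sup>2"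
      using \<open>u \<noteq> 0\<close> by (simp add: field_simps power2_eq_square) (simp add: u_def algebra_simps)
    have ds: "poly (pderiv ?s) (1 / u) = (1 - t) / (2 * u)"
      using \<open>u \<noteq> 0\<close> by (simp add: pderiv_pCons field_simps) (simp add: u_def algebra_simps)
    have "poly (frakB_poly n) t = u ^ n * bernpoly n (1 / u)"
      unfolding u_def using \<open>t > 0\<close> by (intro poly_frakB_poly) simp
    also have "\<dots> = u ^ n * ((\<Sum>j\<le>m. of_nat (j + 2) * coeff F j * (- 1 / 2 * t / u\<^sup>2) ^ (j + 1)) *
        ((1 - t) / (2 * u)))"
      unfolding poly_bernoulli_poly[symmetric] bern poly_mult poly_pcompose s ds dF
      by (simp add: poly_sum poly_monom)
    also have "\<dots> = (\<Sum>j\<le>m. faulhaber_coeff n j * of_nat (j + 2) / 2 * (- 1 / 2) ^ (j + 1) *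
        (t ^ (j + 1) * ((1 - t) * u ^ (2 * (m - j)))))"
      unfolding sum_distrib_left sum_distrib_right
    proof (intro sum.cong refl)
      fix j assume "j \<in> {..m}"
      then have n: "n = 2 * (m - j) + (2 * (j + 1) + 1)"
        using assms by auto
      have pow_n: "u ^ n = u ^ (2 * (m - j)) * (u\<^sup>2) ^ (j + 1) * u"
        unfolding n power_add power_mult[symmetric] by (simp add: power2_eq_square)
      have pow_s: "(- 1 / 2 * t / u\<^sup>2) ^ (j + 1) =
          (- 1 / 2) ^ (j + 1) * t ^ (j + 1) / (u\<^sup>2) ^ (j + 1)"
        by (simp only: power_divide power_mult_distrib)
      \<comment> \<open>Variables stand for the powers, so that the simplifier cancels
        \<open>b\<close>, that is \<open>(u\<^sup>2) ^ (j + 1)\<close>, without expanding any of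
        them.\<close>
      have "a * b * u * (e * f * (g * h / b) * ((1 - t) / (2 * u))) = f * e / 2 * g * (h * ((1 - t) * a))"
        if "b \<noteq> 0" for a b e f g h
        using that \<open>u \<noteq> 0\<close> by simp
      moreover have "(u\<^sup>2) ^ (j + 1) \<noteq> 0"
        using \<open>u \<noteq> 0\<close> by simp
      ultimately show "u ^ n * (of_nat (j + 2) * coeff F j * (- 1 / 2 * t / u\<^sup>2) ^ (j + 1) *
          ((1 - t) / (2 * u))) =
          faulhaber_coeff n j * of_nat (j + 2) / 2 * (- 1 / 2) ^ (j + 1) *
          (t ^ (j + 1) * ((1 - t) * u ^ (2 * (m - j))))"
        unfolding faulhaber_coeff_def faul pow_n pow_s by blast
    qed
    finally show "poly (frakB_poly n) t = poly (\<Sum>j\<le>m.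
        smult (faulhaber_coeff n j * of_nat (j + 2) / 2 * (- 1 / 2) ^ (j + 1))
          (monom 1 (j + 1) * ([:1, -1:] * [:1, 1:] ^ (2 * (m - j))))) t"
      by (simp add: poly_sum poly_monom u_def left_diff_distrib)
  qed
qed

section \<open>Central coefficients and Faulhaber coefficients\<close>

text \<open>For positive \<open>i\<close> this is the difference of the two equal middle entries of
  row \<open>2 * i - 1\<close>. For \<open>i = 0\<close> the exponent is -1, and only the constant
  term counts.\<close>

lemma fps_nth_one_minus_X_binomial_middle:
  "fps_nth ((1 - fps_X) * fps_binomial (of_int (2 * int i - 1) :: 'a :: field_char_0)) i =
    (if i = 0 then 1 else 0)"
proof (cases i)
  case 0
  then show ?thesis by (simp add: fps_mult_nth)
next
  case (Suc r)
  have "(of_int (2 * int i - 1) :: 'a) = of_nat (2 * r + 1)"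
    by (simp add: Suc)
  then have "fps_nth ((1 - fps_X) * fps_binomial (of_int (2 * int i - 1) :: 'a)) i =
      of_nat (2 * r + 1 choose Suc r) - of_nat (2 * r + 1 choose r)"
    by (simp only: left_diff_distrib fps_sub_nth mult_1_left fps_binomial_nth Suc
        fps_X_mult_nth binomial_gbinomial) simp
  also have "\<dots> = 0"
    using binomial_symmetric[of r "2 * r + 1"] by simp
  finally show ?thesis using Suc by simp
qed

lemma frakB_series_central_coeff:
  assumes "odd n" "n \<ge> 3"
  shows "fps_nth (frakB_series n (2 * (int k + 1))) (k + 1) =
    faulhaber_coeff n k * of_nat (k + 2) / 2 * (- 1 / 2) ^ (k + 1)"
proof -
  define m where "m = (n - 3) div 2"
  have n: "n = 2 * m + 3"
    using assms by (auto simp: m_def elim!: oddE)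
  define c where "c j = faulhaber_coeff n j * of_nat (j + 2) / 2 * (- 1 / 2) ^ (j + 1)" for j
  \<comment> \<open>This exponent may be negative, which is why binomial series replace powers
    below.\<close>
  define e where "e = 2 * (int k + 1) - int n"
  have pow: "(1 + fps_X) ^ (2 * (m - j)) * fps_binomial (of_int e) =
      fps_binomial (of_int (2 * (int k - int j) - 1) :: rat)" if "j \<le> m" for j
  proof -
    have "2 * (int k - int j) - 1 = int (2 * (m - j)) + e"
      using that by (simp add: e_def n)
    then have "(of_int (2 * (int k - int j) - 1) :: rat) = of_nat (2 * (m - j)) + of_int e"
      by (metis of_int_add of_int_of_nat_eq)
    then show ?thesis
      by (simp only: fps_binomial_add_mult fps_binomial_of_nat)
  qed
  have "frakB_series n (2 * (int k + 1)) = (\<Sum>j\<le>m. fps_const (c j) * (fps_X ^ (j + 1) *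
      ((1 - fps_X) * ((1 + fps_X) ^ (2 * (m - j)) * fps_binomial (of_int e)))))"
    unfolding frakB_series_def frakB_poly_faulhaber(2)[OF n] c_def[symmetric] e_def[symmetric]
      fps_of_poly_sum sum_distrib_right
    by (intro sum.cong refl)
      (simp only: fps_of_poly_smult fps_of_poly_mult fps_of_poly_power fps_of_poly_monom'
        fps_of_poly_linear' mult.assoc, simp flip: fps_const_neg)
  also have "\<dots> = (\<Sum>j\<le>m. fps_const (c j) * (fps_X ^ (j + 1) *
      ((1 - fps_X) * fps_binomial (of_int (2 * (int k - int j) - 1)))))"
    by (intro sum.cong refl) (simp only: pow atMost_iff)
  finally have "fps_nth (frakB_series n (2 * (int k + 1))) (k + 1) = (\<Sum>j\<le>m. c j * fps_nth
      (fps_X ^ (j + 1) * ((1 - fps_X) * fps_binomial (of_int (2 * (int k - int j) - 1)))) (k + 1))"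
    by (simp only: fps_sum_nth fps_mult_left_const_nth)
  \<comment> \<open>Terms with \<open>j > k\<close> start beyond \<open>fps_X ^ (k + 1)\<close>;
    those with \<open>j < k\<close> vanish by the middle binomial identity.\<close>
  also have "\<dots> = (\<Sum>j\<le>m. if j = k then c k else 0)"
  proof (intro sum.cong refl)
    fix j
    show "c j * fps_nth (fps_X ^ (j + 1) *
        ((1 - fps_X) * fps_binomial (of_int (2 * (int k - int j) - 1)))) (k + 1) =
        (if j = k then c k else 0)"
    proof (cases "j \<le> k")
      case True
      then have "int k - int j = int (k - j)" by simp
      then have "fps_nth ((1 - fps_X) * fps_binomial (of_int (2 * (int k - int j) - 1) :: rat)) (k - j) =
          (if k - j = 0 then 1 else 0)"
        by (simp only: fps_nth_one_minus_X_binomial_middle)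
      then show ?thesis
        using True unfolding fps_X_power_mult_nth by auto
    qed (simp add: fps_X_power_mult_nth del: power_Suc)
  qed
  \<comment> \<open>If \<open>k > m\<close>, no index matches, and \<open>c k\<close> is itself 0 by
    the degree bound.\<close>
  also have "\<dots> = c k"
    using frakB_poly_faulhaber(1)[OF n]
    by (auto simp: c_def faulhaber_coeff_def intro: coeff_eq_0)
  finally show ?thesis
    by (simp only: c_def)
qed

lemma faulhaber_coeff_eq:
  assumes "odd n" "n \<ge> 3"
  shows "faulhaber_coeff n k = (- 1) ^ (k + 1) * (2 ^ (k + 2) / of_nat (k + 2)) *
    fps_nth (frakB_series n (2 * (int k + 1))) (k + 1)"
proof -
  have "(- 1) ^ (k + 1) * (2 ^ (k + 2) / a) * (f * a / 2 * (- 1 / 2) ^ (k + 1)) = f"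
    if "a \<noteq> 0" for f a :: rat
    using that by (simp add: power_divide field_simps flip: power_mult_distrib)
  from this[of "of_nat (k + 2)" "faulhaber_coeff n k"] show ?thesis
    unfolding frakB_series_central_coeff[OF assms] by (simp del: of_nat_add)
qed

theorem theorem10p4:
  shows "(\<forall>n k. n \<le> k \<longrightarrow>
            (\<exists>p. frakB_series n (int k) = fps_of_poly p \<and>
                 quasipalindromic k p \<and>
                 fps_to_fls (frakB_series n (int k)) =
                   (- 1) ^ n * fls_X ^ k * poly_at_X_inv p))
       \<and> (\<forall>n. odd n \<and> n \<ge> 3 \<longrightarrow>
            (\<forall>k. faulhaber_coeff n k =
                  (- 1) ^ (k + 1) * (2 ^ (k + 2) / of_nat (k + 2)) *
                  fps_nth (frakB_series n (2 * (int k + 1))) (k + 1)))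
       \<and> (\<forall>n. odd n \<and> n \<ge> 3 \<longrightarrow>
            (\<forall>k. (n + 1) div 2 \<le> k \<longrightarrow> fps_nth (frakB_series n (2 * int k)) k = 0)
          \<and> (\<forall>k. faulhaber_deg n + 1 \<le> k \<longrightarrow> faulhaber_coeff n k = 0))"
proof (intro conjI allI impI)
  fix n k :: nat
  assume n: "odd n \<and> n \<ge> 3"
  show "faulhaber_coeff n k = (- 1) ^ (k + 1) * (2 ^ (k + 2) / of_nat (k + 2)) *
      fps_nth (frakB_series n (2 * (int k + 1))) (k + 1)"
    using n by (intro faulhaber_coeff_eq) auto
  show "fps_nth (frakB_series n (2 * int k)) k = 0" if "(n + 1) div 2 \<le> k"
    using n that by (intro frakB_series_central_zero) (auto elim!: oddE)
  show "faulhaber_coeff n k = 0" if "faulhaber_deg n + 1 \<le> k"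
  proof -
    \<comment> \<open>Thus \<open>faulhaber_deg n\<close> is the \<open>m\<close> of
      \<open>frakB_poly_faulhaber\<close>, whose degree bound gives the vanishing.\<close>
    have "n = 2 * faulhaber_deg n + 3"
      using n by (auto simp: faulhaber_deg_def elim!: oddE)
    then have "degree (faulhaber_poly n) < k"
      using frakB_poly_faulhaber(1) that by fastforce
    then show ?thesis
      by (simp add: faulhaber_coeff_def coeff_eq_0)
  qed
qed (rule frakB_series_quasipalindromic)

end
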